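(* Under Rayleigh fading, let $P_{\rm r}>0$ and $\mathcal C_x\in[0,1)$, put $\alpha=\frac{P_{\rm r}\pi_{\rm rr}}{P_{\rm r}\pi_{\rm rr}+1}$, $a_i=1+(-1)^i\alpha\mathcal C_x$ for $i=1,2$, $D=P_{\rm r}\pi_{\rm rd}(1-\mathcal C_x^2)$, and assume $D\neq P_{\rm s}\pi_{\rm sd}a_i$ for $i=1,2$. Then the ergodic rate $\mathcal R_{\rm E-E}=\mathbb E[\min(R_{\rm sr},R_{\rm rd})]$ satisfies \[ \mathcal R_{\rm E-E}\ge\frac{D}{P_{\rm s}\pi_{\rm sd}\ln 2}\left(\sum_{i=1}^2\kappa_i\,\Xi_1\!\left(\frac{P_{\rm r}\pi_{\rm rr}a_i}{\alpha P_{\rm s}\pi_{\rm sr}}+\frac{a_i}{D}\right)+\kappa_3\,\Xi_1\!\left(\frac{P_{\rm r}^2\pi_{\rm rd}\pi_{\rm rr}(1-\mathcal C_x^2)}{\alpha P_{\rm s}^2\pi_{\rm sd}\pi_{\rm sr}}+\frac1{P_{\rm s}\pi_{\rm sd}}\right)\right), \] where $\kappa_i=\frac{0.5\,P_{\rm s}\pi_{\rm sd}}{D-P_{\rm s}\pi_{\rm sd}a_i}$ for $i=1,2$ and $\kappa_3=\frac{P_{\rm s}\pi_{\rm sd}(P_{\rm s}\pi_{\rm sd}-D)}{(D-P_{\rm s}\pi_{\rm sd}(1-\alpha\mathcal C_x))(D-P_{\rm s}\pi_{\rm sd}(1+\alpha\mathcal C_x))}$.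
   Context: Let $P_{\rm s}>0$, $P_{\rm r}>0$ be the source and relay transmit powers. Rayleigh fading: $g_{\rm sr},g_{\rm rr},g_{\rm rd},g_{\rm sd}$ are mutually independent exponential random variables with means $\pi_{\rm sr},\pi_{\rm rr},\pi_{\rm rd},\pi_{\rm sd}>0$. For $\mathcal C_x\in[0,1)$ define $R_{\rm sr}(P_{\rm r},\mathcal C_x)=\tfrac12\log_2\frac{(P_{\rm s}g_{\rm sr}+P_{\rm r}g_{\rm rr}+1)^2-(P_{\rm r}g_{\rm rr}\mathcal C_x)^2}{(P_{\rm r}g_{\rm rr}+1)^2-(P_{\rm r}g_{\rm rr}\mathcal C_x)^2}$ and $R_{\rm rd}(P_{\rm r},\mathcal C_x)=\tfrac12\log_2\frac{(P_{\rm r}g_{\rm rd}+P_{\rm s}g_{\rm sd}+1)^2-(P_{\rm r}g_{\rm rd}\mathcal C_x)^2}{(P_{\rm s}g_{\rm sd}+1)^2}$. $\Xi_1(x)=e^xE_1(x)$ where $E_1(x)=\int_1^\infty e^{-xt}t^{-1}dt$ is the exponential integral. *)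

theory Defs
  imports "HOL-Probability.Probability"
begin

definition E1 :: "real \<Rightarrow> real" where
  "E1 x = (LBINT t:{1..}. exp (- x * t) / t)"

definition Xi1 :: "real \<Rightarrow> real" where
  "Xi1 x = exp x * E1 x"

definition R_sr :: "real \<Rightarrow> real \<Rightarrow> real \<Rightarrow> real \<Rightarrow> real \<Rightarrow> real" where
  "R_sr Ps Pr Cx gsr grr =
     1/2 * log 2 (((Ps*gsr + Pr*grr + 1)^2 - (Pr*grr*Cx)^2) / ((Pr*grr + 1)^2 - (Pr*grr*Cx)^2))"

definition R_rd :: "real \<Rightarrow> real \<Rightarrow> real \<Rightarrow> real \<Rightarrow> real \<Rightarrow> real" where
  "R_rd Ps Pr Cx grd gsd =
     1/2 * log 2 (((Pr*grd + Ps*gsd + 1)^2 - (Pr*grd*Cx)^2) / (Ps*gsd + 1)^2)"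

text \<open>Ergodic rate E[min(R_sr, R_rd)] with g_sr, g_rr, g_rd, g_sd independent exponential
  with means pi_sr, pi_rr, pi_rd, pi_sd (rates 1/pi): integral against the joint density.\<close>
definition ergodic_rate_EE ::
  "real \<Rightarrow> real \<Rightarrow> real \<Rightarrow> real \<Rightarrow> real \<Rightarrow> real \<Rightarrow> real \<Rightarrow> real" where
  "ergodic_rate_EE Ps Pr Cx pi_sr pi_rr pi_rd pi_sd =
     (\<integral>g. (case g of (gsr, grr, grd, gsd) \<Rightarrow>
        min (R_sr Ps Pr Cx gsr grr) (R_rd Ps Pr Cx grd gsd) *
        (exponential_density (1/pi_sr) gsr * exponential_density (1/pi_rr) grr *
         exponential_density (1/pi_rd) grd * exponential_density (1/pi_sd) gsd))
      \<partial>(lborel :: (real \<times> real \<times> real \<times> real) measure))"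

end

theory Submission
  imports Defs
begin

text \<open>
  Write \<open>p = P\<^sub>r \<pi>\<^sub>r\<^sub>r\<close>, \<open>\<beta> = \<alpha> \<C>\<^sub>x\<close> and
  \<open>\<phi>(x) = 1/2 log\<^sub>2(((1+x)\<^sup>2 - \<beta>\<^sup>2)/(1 - \<beta>\<^sup>2))\<close>.
  The event \<open>R\<^sub>s\<^sub>r > \<phi>(x)\<close> says that \<open>P\<^sub>s g\<^sub>s\<^sub>r\<close> exceeds a threshold which is a concave function
  of \<open>r = P\<^sub>r g\<^sub>r\<^sub>r\<close> with value \<open>(p+1)x\<close> at \<open>r = p\<close>; replacing it by its tangent at the mean \<open>p\<close>
  and using \<open>e\<^sup>u \<ge> 1 + u\<close> gives \<open>P(R\<^sub>s\<^sub>r > \<phi>(x)) \<ge> exp(-(p+1)x/(P\<^sub>s \<pi>\<^sub>s\<^sub>r))\<close>.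
  As \<open>\<beta> \<le> \<C>\<^sub>x\<close>, also \<open>R\<^sub>r\<^sub>d \<ge> \<phi>(B)\<close> with
  \<open>B = P\<^sub>r g\<^sub>r\<^sub>d (1 - \<C>\<^sub>x\<^sup>2)/(P\<^sub>s g\<^sub>s\<^sub>d + 1)\<close>, and \<open>P(B > x) = e\<^bsup>-x/D\<^esup>/(1 + x P\<^sub>s \<pi>\<^sub>s\<^sub>d/D)\<close>.
  By independence the ergodic rate is at least \<open>\<integral> \<phi>'(x) P(R\<^sub>s\<^sub>r > \<phi>(x)) P(B > x) dx\<close> over
  \<open>x \<ge> 0\<close>, and partial fractions turn the resulting integral into values of \<open>\<Xi>\<^sub>1\<close>.
\<close>

section \<open>Exponential densities and iterated integrals over the four gains\<close>

lemma nn_integral_exponential_density: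
  assumes "0 < l"
  shows "(\<integral>\<^sup>+t. ennreal (exponential_density l t) \<partial>lborel) = 1"
proof -
  interpret prob_space "density lborel (exponential_density l)"
    by (rule prob_space_exponential_density[OF assms])
  show ?thesis
    using emeasure_space_1 by (simp add: emeasure_density)
qed

text \<open>The factor \<open>exp (- c * t)\<close> only shifts the rate from \<open>l\<close> to
  \<open>l + c\<close>. A negative \<open>c\<close> is allowed, which the finiteness proof for the
  ergodic rate exploits.\<close>

lemma nn_integral_exponential_density_exp:
  assumes "0 < l" "0 < l + c"
  shows "(\<integral>\<^sup>+t. ennreal (exponential_density l t) * ennreal (exp (- c * t)) \<partial>lborel)
           = ennreal (l / (l + c))"
proof -
  have "ennreal (exponential_density l t) * ennreal (exp (- c * t))
          = ennreal (l / (l + c)) * ennreal (exponential_density (l + c) t)" for t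
  proof -
    have "exp (- t * l) * exp (- c * t) = exp (- t * (l + c))"
      by (simp add: exp_add[symmetric] algebra_simps)
    then show ?thesis
      using assms by (simp add: exponential_density_def ennreal_mult[symmetric])
  qed
  then show ?thesis
    using assms by (simp add: nn_integral_cmult nn_integral_exponential_density)
qed

lemma nn_integral_exponential_density_tail:
  assumes "0 < l" "0 \<le> c"
  shows "(\<integral>\<^sup>+t. ennreal (exponential_density l t) * (if c < t then 1 else 0) \<partial>lborel) = ennreal (exp (- l * c))"
proof -
  have "(\<integral>\<^sup>+t. ennreal (exponential_density l t) * (if c < t then 1 else 0) \<partial>lborel)
      = (\<integral>\<^sup>+t. ennreal (l * exp (- l * t)) * indicator {c..} t \<partial>lborel)"
    \<comment> \<open>The strict event \<open>c < t\<close> and the closed ray \<open>{c..}\<close>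
      differ only in the null set \<open>{c}\<close>.\<close>
    using assms AE_lborel_singleton[of c]
    by (intro nn_integral_cong_AE)
       (auto elim!: eventually_mono simp: exponential_density_def indicator_def mult.commute)
  also have "\<dots> = ennreal (0 - (- exp (- l * c)))"
  proof (rule nn_integral_FTC_atLeast)
    show "((\<lambda>t. - exp (- l * t)) \<longlongrightarrow> 0) at_top"
      using assms by real_asymp
  qed (use assms in \<open>auto intro!: derivative_eq_intros\<close>)
  finally show ?thesis by simp
qed

lemma nn_integral_lborel_prod4:
  fixes f :: "real \<times> real \<times> real \<times> real \<Rightarrow> ennreal"
  assumes [measurable]: "f \<in> borel_measurable borel"
  shows "(\<integral>\<^sup>+g. f g \<partial>lborel)
    = (\<integral>\<^sup>+a. \<integral>\<^sup>+b. \<integral>\<^sup>+c. \<integral>\<^sup>+d. f (a, b, c, d) \<partial>lborel \<partial>lborel \<partial>lborel \<partial>lborel)"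
proof -
  have split: "(\<integral>\<^sup>+z. h z \<partial>lborel) = (\<integral>\<^sup>+x. \<integral>\<^sup>+y. h (x, y) \<partial>lborel \<partial>lborel)"
    if "h \<in> borel_measurable borel" for h :: "real \<times> 'b::euclidean_space \<Rightarrow> ennreal"
    using that by (simp add: lborel.nn_integral_fst borel_prod lborel_prod)
  show ?thesis
    by (simp add: split)
qed

text \<open>Independence of the two hops. Each factor is also reordered so that the gain compared
  with a threshold (\<open>gsr\<close>, respectively \<open>grd\<close>) is integrated first, which
  makes the inner integral an exponential tail.\<close>

lemma nn_integral_lborel_prod4_times:
  fixes F G :: "real \<Rightarrow> real \<Rightarrow> ennreal"
  assumes F[measurable]: "case_prod F \<in> borel_measurable (borel \<Otimes>\<^sub>M borel)"
    and G[measurable]: "case_prod G \<in> borel_measurable (borel \<Otimes>\<^sub>M borel)"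
  shows "(\<integral>\<^sup>+g. (case g of (a, b, c, d) \<Rightarrow> F a b * G c d) \<partial>lborel)
    = (\<integral>\<^sup>+b. \<integral>\<^sup>+a. F a b \<partial>lborel \<partial>lborel) * (\<integral>\<^sup>+d. \<integral>\<^sup>+c. G c d \<partial>lborel \<partial>lborel)"
proof -
  have "(\<lambda>g. case g of (a, b, c, d) \<Rightarrow> F a b * G c d) \<in> borel_measurable (borel \<Otimes>\<^sub>M borel \<Otimes>\<^sub>M borel \<Otimes>\<^sub>M borel)"
    by measurable
  then have "(\<integral>\<^sup>+g. (case g of (a, b, c, d) \<Rightarrow> F a b * G c d) \<partial>lborel)
    = (\<integral>\<^sup>+a. \<integral>\<^sup>+b. \<integral>\<^sup>+c. \<integral>\<^sup>+d. F a b * G c d \<partial>lborel \<partial>lborel \<partial>lborel \<partial>lborel)"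
    by (subst nn_integral_lborel_prod4) (simp_all add: borel_prod)
  also have "\<dots> = (\<integral>\<^sup>+a. \<integral>\<^sup>+b. F a b \<partial>lborel \<partial>lborel) * (\<integral>\<^sup>+c. \<integral>\<^sup>+d. G c d \<partial>lborel \<partial>lborel)"
    by (simp add: nn_integral_cmult nn_integral_multc)
  also have "(\<integral>\<^sup>+a. \<integral>\<^sup>+b. F a b \<partial>lborel \<partial>lborel) = (\<integral>\<^sup>+b. \<integral>\<^sup>+a. F a b \<partial>lborel \<partial>lborel)"
    by (rule lborel_pair.Fubini'[symmetric]) simp
  also have "(\<integral>\<^sup>+a. \<integral>\<^sup>+b. G a b \<partial>lborel \<partial>lborel) = (\<integral>\<^sup>+b. \<integral>\<^sup>+a. G a b \<partial>lborel \<partial>lborel)"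
    by (rule lborel_pair.Fubini'[symmetric]) simp
  finally show ?thesis .
qed

section \<open>The function \<open>Xi1\<close> as a Laplace-type integral\<close>

text \<open>The substitution \<open>t = 1 + x / b\<close> in \<open>E1 (\<mu> * b)\<close> splits
  off the factor \<open>exp (- (\<mu> * b))\<close>, which \<open>Xi1\<close> cancels.\<close>

lemma Xi1_eq_integral:
  fixes \<mu> b :: real
  assumes "0 < \<mu>" "0 < b"
  shows "integrable lborel (\<lambda>x. indicator {0..} x * (exp (- \<mu> * x) / (x + b)))"
    and "(\<integral>x. indicator {0..} x * (exp (- \<mu> * x) / (x + b)) \<partial>lborel) = Xi1 (\<mu> * b)"
proof -
  have "integrable lborel (\<lambda>x. exponential_density \<mu> x)"
    using nn_integral_exponential_density[of \<mu>] assms exponential_density_nonneg[of \<mu>]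
    by (intro integrableI_nonneg) auto
  then show "integrable lborel (\<lambda>x. indicator {0..} x * (exp (- \<mu> * x) / (x + b)))"
  \<comment> \<open>Since \<open>1 / (x + b)\<close> is at most \<open>1 / b\<close> on
    \<open>x \<ge> 0\<close>, the integrand is dominated by \<open>1 / (\<mu> * b)\<close> times the
    exponential density of rate \<open>\<mu>\<close>.\<close>
  proof (rule Bochner_Integration.integrable_bound[OF integrable_mult_right[where c = "1 / (\<mu> * b)"]], goal_cases)
    case 2
    have "exp (- \<mu> * x) / (x + b) \<le> exp (- \<mu> * x) / b" if "x \<ge> 0" for x
      using that assms by (intro divide_left_mono) auto
    then show ?case
      using assms by (auto simp: exponential_density_def indicator_def mult.commute)
  qed auto
  have "E1 (\<mu> * b) = (\<integral>t. indicator {1..} t * (exp (- (\<mu> * b) * t) / t) \<partial>lborel)"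
    by (simp add: E1_def set_lebesgue_integral_def)
  also have "\<dots> = (1 / b) * (\<integral>x. indicator {1..} (1 + (1 / b) * x) *
                (exp (- (\<mu> * b) * (1 + (1 / b) * x)) / (1 + (1 / b) * x)) \<partial>lborel)"
    using assms by (subst lborel_integral_real_affine[where c = "1 / b" and t = 1]) auto
  also have "\<dots> = (\<integral>x. exp (- (\<mu> * b)) * (indicator {0..} x * (exp (- \<mu> * x) / (x + b))) \<partial>lborel)"
    unfolding Bochner_Integration.integral_mult_right_zero[symmetric]
  proof (rule Bochner_Integration.integral_cong[OF refl])
    fix x
    show "1 / b * (indicator {1..} (1 + 1 / b * x) * (exp (- (\<mu> * b) * (1 + 1 / b * x)) / (1 + 1 / b * x)))
      = exp (- (\<mu> * b)) * (indicator {0..} x * (exp (- \<mu> * x) / (x + b)))"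
    proof (cases "x \<ge> 0")
      case True
      have "- (\<mu> * b) * (1 + 1 / b * x) = - (\<mu> * b) + - \<mu> * x"
        using assms by (simp add: field_simps)
      then have e: "exp (- (\<mu> * b) * (1 + 1 / b * x)) = exp (- (\<mu> * b)) * exp (- \<mu> * x)"
        by (simp add: exp_add[symmetric])
      show ?thesis
        unfolding e using True assms by (simp add: indicator_def field_simps)
    next
      case False
      then show ?thesis using assms by (simp add: indicator_def field_simps)
    qed
  qed
  finally have "E1 (\<mu> * b) = exp (- (\<mu> * b)) * (\<integral>x. indicator {0..} x * (exp (- \<mu> * x) / (x + b)) \<partial>lborel)"
    unfolding Bochner_Integration.integral_mult_right_zero .
  then show "(\<integral>x. indicator {0..} x * (exp (- \<mu> * x) / (x + b)) \<partial>lborel) = Xi1 (\<mu> * b)"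
    by (simp add: Xi1_def exp_minus)
qed

section \<open>Threshold levels and algebraic comparison of the SNR factors\<close>

definition snr_factor :: "real \<Rightarrow> real \<Rightarrow> real" where
  "snr_factor b x = ((1 + x)\<^sup>2 - b\<^sup>2) / (1 - b\<^sup>2)"

text \<open>
  For \<open>K = snr_factor (p * c / (p + 1)) x\<close>, the received SNR factor of the source hop exceeds \<open>K\<close>
  iff \<open>s > sqrt (q r) - (r + 1)\<close>, where \<open>q r = (K - (K - 1) * c\<^sup>2) * r\<^sup>2 + 2 * K * r + K\<close> and
  \<open>q p = ((p + 1) * (1 + x))\<^sup>2\<close>; the slope below is the derivative of the right-hand side at \<open>r = p\<close>.
\<close>
definition threshold_slope :: "real \<Rightarrow> real \<Rightarrow> real \<Rightarrow> real" where
  "threshold_slope c p x = (let K = snr_factor (p * c / (p + 1)) x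
     in ((K - (K - 1) * c\<^sup>2) * p + K) / ((p + 1) * (1 + x)) - 1)"

text \<open>The tangent is used instead of the exact threshold because it is affine in
  \<open>r\<close>, so averaging over the interference gain becomes a Laplace transform of an
  exponential density.\<close>

definition threshold :: "real \<Rightarrow> real \<Rightarrow> real \<Rightarrow> real \<Rightarrow> real" where
  "threshold c p x r = (p + 1) * x + threshold_slope c p x * (r - p)"

text \<open>After multiplication by \<open>1 - b\<^sup>2\<close> the difference of the two sides is
  \<open>x\<^sup>2 + 2 * x * b\<^sup>2\<close>.\<close>

lemma snr_factor_ge:
  assumes "0 \<le> b" "b < 1" "0 \<le> x"
  shows "1 + 2 * x \<le> snr_factor b x"
proof -
  have "b\<^sup>2 < 1" using assms by (simp add: abs_square_less_1)
  moreover have "0 \<le> x\<^sup>2" "0 \<le> b\<^sup>2 * (2 * x)" using assms by auto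
  ultimately show ?thesis
    unfolding snr_factor_def by (simp add: field_simps power2_eq_square)
qed

lemma snr_factor_less:
  assumes "0 \<le> b" "b < 1" "0 \<le> x" "x < y"
  shows "snr_factor b x < snr_factor b y"
proof -
  have "b\<^sup>2 < 1" using assms by (simp add: abs_square_less_1)
  moreover have "(1 + x)\<^sup>2 < (1 + y)\<^sup>2" using assms by (intro power_strict_mono) auto
  ultimately show ?thesis
    unfolding snr_factor_def by (intro divide_strict_right_mono) auto
qed

lemma threshold_slope_props:
  fixes c p x :: real
  assumes "0 \<le> c" "c < 1" "0 < p" "0 \<le> x"
  defines "K \<equiv> snr_factor (p * c / (p + 1)) x"
  defines "A \<equiv> K - (K - 1) * c\<^sup>2"
  shows "1 + 2 * x \<le> K" "1 \<le> A"
    and "A * p\<^sup>2 + 2 * K * p + K = ((p + 1) * (1 + x))\<^sup>2"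
    and "0 \<le> threshold_slope c p x"
    and "threshold_slope c p x = (A * p + K) / ((p + 1) * (1 + x)) - 1"
proof -
  define T where "T = (p + 1) * (1 + x)"
  have T: "T > 0" using assms by (simp add: T_def)
  have "p * c \<le> p * 1" using assms(1-4) by (intro mult_left_mono) auto
  then have "p * c < p + 1" by simp
  then have b: "0 \<le> p * c / (p + 1)" "p * c / (p + 1) < 1" using assms by auto
  show K: "1 + 2 * x \<le> K" unfolding K_def using b assms by (intro snr_factor_ge)
  have "c\<^sup>2 \<le> 1" using assms by (simp add: abs_square_le_1)
  then have "(K - 1) * c\<^sup>2 \<le> (K - 1) * 1" using K assms by (intro mult_left_mono) auto
  then show A: "1 \<le> A" by (simp add: A_def)
  have "0 < (p + 1)\<^sup>2 - (p * c)\<^sup>2"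
    using \<open>p * c < p + 1\<close> assms by (simp add: power_strict_mono)
  \<comment> \<open>The choice \<open>b = p * c / (p + 1)\<close> makes \<open>K\<close> the SNR
    factor of the source hop at \<open>r = p\<close> with \<open>s = (p + 1) * x\<close>.\<close>
  moreover have "K = (T\<^sup>2 - (p * c)\<^sup>2) / ((p + 1)\<^sup>2 - (p * c)\<^sup>2)"
  proof -
    have "K = ((p + 1)\<^sup>2 * ((1 + x)\<^sup>2 - (p * c / (p + 1))\<^sup>2)) / ((p + 1)\<^sup>2 * (1 - (p * c / (p + 1))\<^sup>2))"
      using assms by (simp add: K_def snr_factor_def)
    moreover have "(p + 1)\<^sup>2 * (p * c / (p + 1))\<^sup>2 = (p * c)\<^sup>2"
      using assms by (simp add: power_divide)
    ultimately show ?thesis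
      by (simp add: T_def right_diff_distrib power_mult_distrib)
  qed
  ultimately have "K * ((p + 1)\<^sup>2 - (p * c)\<^sup>2) = T\<^sup>2 - (p * c)\<^sup>2" by simp
  then have q: "A * p\<^sup>2 + 2 * K * p + K = T\<^sup>2"
    by (simp add: A_def power2_eq_square algebra_simps)
  then show "A * p\<^sup>2 + 2 * K * p + K = ((p + 1) * (1 + x))\<^sup>2" by (simp add: T_def)
  show s: "threshold_slope c p x = (A * p + K) / ((p + 1) * (1 + x)) - 1"
    by (simp add: threshold_slope_def Let_def K_def A_def)
  \<comment> \<open>The slope is nonnegative iff \<open>T \<le> A * p + K\<close>. Squaring and
    replacing \<open>T\<^sup>2\<close> by \<open>q p\<close> leaves terms that are nonnegative
    because \<open>A\<close> and \<open>K\<close> are at least 1.\<close>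
  have "(A * p + K)\<^sup>2 - T\<^sup>2 = A * (A - 1) * p\<^sup>2 + 2 * K * (A - 1) * p + K * (K - 1)"
    unfolding q[symmetric] by (simp add: power2_eq_square algebra_simps)
  also have "\<dots> \<ge> 0" using A K assms by auto
  finally have "T \<le> A * p + K"
    using A K assms by (intro power2_le_imp_le[of T]) auto
  then show "0 \<le> threshold_slope c p x" using T s by (simp add: T_def)
qed

text \<open>The slope is nonnegative, so the worst case is \<open>r = 0\<close>; there
  \<open>1 + x \<le> K\<close> suffices. Nonnegativity is needed for the exponential tail
  formula.\<close>

lemma threshold_nonneg:
  assumes "0 \<le> c" "c < 1" "0 < p" "0 \<le> x" "0 \<le> r"
  shows "0 \<le> threshold c p x r"
proof -
  define K where "K = snr_factor (p * c / (p + 1)) x"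
  define A where "A = K - (K - 1) * c\<^sup>2"
  note f = threshold_slope_props[OF assms(1-4), folded K_def, folded A_def]
  define T where "T = (p + 1) * (1 + x)"
  have T: "T > 0" using assms by (simp add: T_def)
  have "threshold_slope c p x * p * T = (A * p + K) * p - T * p"
    using T by (simp add: f(5)[folded T_def] field_simps)
  also have "\<dots> = T\<^sup>2 - K * (p + 1) - T * p"
    using f(3)[folded T_def] by (simp add: power2_eq_square algebra_simps)
  also have "\<dots> \<le> T\<^sup>2 - (1 + x) * (p + 1) - T * p"
    using f(1) assms mult_right_mono[of "1 + x" K "p + 1"] by auto
  also have "\<dots> = ((p + 1) * x) * T"
    by (simp add: T_def power2_eq_square algebra_simps)
  finally have "threshold_slope c p x * p \<le> (p + 1) * x"
    using T by (simp only: mult_le_cancel_right_pos)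
  moreover have "0 \<le> threshold_slope c p x * r" using f(4) assms by simp
  ultimately show ?thesis by (simp add: threshold_def right_diff_distrib)
qed

text \<open>The tangent lies above the concave exact threshold, so exceeding the tangent forces the
  SNR factor up to \<open>K\<close>.\<close>

lemma snr_factor_le_sr:
  assumes "0 \<le> c" "c < 1" "0 < p" "0 \<le> x" "0 \<le> r" "threshold c p x r \<le> s"
  shows "snr_factor (p * c / (p + 1)) x \<le> ((s + r + 1)\<^sup>2 - (r * c)\<^sup>2) / ((r + 1)\<^sup>2 - (r * c)\<^sup>2)"
proof -
  define K where "K = snr_factor (p * c / (p + 1)) x"
  define A where "A = K - (K - 1) * c\<^sup>2"
  note f = threshold_slope_props[OF assms(1-4), folded K_def, folded A_def]
  define T where "T = (p + 1) * (1 + x)"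
  have T: "T > 0" using assms by (simp add: T_def)
  define L where "L = (A * r * p + K * (r + p) + K) / T"
  have "r + 1 + threshold c p x r = T + (threshold_slope c p x + 1) * (r - p)"
    by (simp add: threshold_def T_def algebra_simps)
  also have "\<dots> = (T\<^sup>2 + (A * p + K) * (r - p)) / T"
    using T by (simp add: f(5)[folded T_def] field_simps power2_eq_square)
  also have "T\<^sup>2 + (A * p + K) * (r - p) = A * r * p + K * (r + p) + K"
    unfolding f(3)[folded T_def, symmetric] by (simp add: power2_eq_square algebra_simps)
  finally have L: "r + 1 + threshold c p x r = L" by (simp add: L_def)
  \<comment> \<open>Concavity in exact form: with
    \<open>q r = A * r\<^sup>2 + 2 * K * r + K\<close>, the gap between
    \<open>(T * L)\<^sup>2\<close> and \<open>T\<^sup>2 * q r\<close> is a nonnegative multiple of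
    \<open>(r - p)\<^sup>2\<close>.\<close>
  have "T\<^sup>2 * (A * r\<^sup>2 + 2 * K * r + K) + K * (K - 1) * c\<^sup>2 * (r - p)\<^sup>2 = (A * r * p + K * (r + p) + K)\<^sup>2"
    unfolding f(3)[folded T_def, symmetric] A_def by algebra
  moreover have "0 \<le> K * (K - 1) * c\<^sup>2 * (r - p)\<^sup>2" using f(1) assms by auto
  ultimately have "T\<^sup>2 * (A * r\<^sup>2 + 2 * K * r + K) \<le> (A * r * p + K * (r + p) + K)\<^sup>2" by linarith
  then have "A * r\<^sup>2 + 2 * K * r + K \<le> L\<^sup>2"
    using T by (simp add: L_def power_divide pos_le_divide_eq mult.commute)
  also have "\<dots> \<le> (s + r + 1)\<^sup>2"
    using L threshold_nonneg[OF assms(1-5)] assms by (intro power_mono) auto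
  finally have "K * ((r + 1)\<^sup>2 - (r * c)\<^sup>2) \<le> (s + r + 1)\<^sup>2 - (r * c)\<^sup>2"
    by (simp add: A_def power2_eq_square algebra_simps)
  moreover have "r * c \<le> r * 1" using assms by (intro mult_left_mono) auto
  then have "0 < (r + 1)\<^sup>2 - (r * c)\<^sup>2" using assms by (simp add: power_strict_mono)
  ultimately show ?thesis by (simp add: K_def pos_le_divide_eq)
qed

text \<open>In terms of \<open>t = d / (q + 1)\<close> both sides are quadratic polynomials in
  \<open>t\<close>, and the inequality holds coefficient by coefficient because
  \<open>b \<le> c\<close>.\<close>

lemma snr_factor_le_rd:
  assumes "0 \<le> b" "b \<le> c" "c < 1" "0 \<le> d" "0 \<le> q"
  shows "snr_factor b (d * (1 - c\<^sup>2) / (q + 1)) \<le> ((d + q + 1)\<^sup>2 - (d * c)\<^sup>2) / (q + 1)\<^sup>2"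
proof -
  define t where "t = d / (q + 1)"
  have t: "0 \<le> t" "d = t * (q + 1)" using assms by (auto simp: t_def)
  have c: "c\<^sup>2 < 1" "b\<^sup>2 \<le> c\<^sup>2" using assms by (auto simp: abs_square_less_1 power_mono)
  have "2 * t * (1 - c\<^sup>2) \<le> 2 * t * (1 - b\<^sup>2)" using t c by (intro mult_left_mono) auto
  moreover have "(t\<^sup>2 * (1 - c\<^sup>2)) * (1 - c\<^sup>2) \<le> (t\<^sup>2 * (1 - c\<^sup>2)) * (1 - b\<^sup>2)"
    using t c by (intro mult_left_mono) auto
  ultimately have "(1 + t * (1 - c\<^sup>2))\<^sup>2 - b\<^sup>2 \<le> ((1 + t)\<^sup>2 - (t * c)\<^sup>2) * (1 - b\<^sup>2)"
    by (simp add: power2_eq_square algebra_simps)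
  then have "snr_factor b (t * (1 - c\<^sup>2)) \<le> (1 + t)\<^sup>2 - (t * c)\<^sup>2"
    using c by (simp add: snr_factor_def pos_divide_le_eq)
  also have "\<dots> = ((q + 1)\<^sup>2 * ((1 + t)\<^sup>2 - (t * c)\<^sup>2)) / (q + 1)\<^sup>2"
    using assms by simp
  also have "(q + 1)\<^sup>2 * ((1 + t)\<^sup>2 - (t * c)\<^sup>2) = (d + q + 1)\<^sup>2 - (d * c)\<^sup>2"
    unfolding t(2) by algebra
  finally show ?thesis by (simp add: t_def)
qed

section \<open>The rate function and its layer-cake bound\<close>

lemma has_derivative_log_snr_factor:
  assumes "0 \<le> b" "b < 1" "0 \<le> x"
  shows "((\<lambda>x. 1/2 * log 2 (snr_factor b x)) has_real_derivative
           (1 / (x + (1 - b)) + 1 / (x + (1 + b))) / (2 * ln 2)) (at x)"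
proof -
  have b: "1 - b\<^sup>2 > 0" using assms by (simp add: abs_square_less_1)
  have eq: "snr_factor b y = (y + (1 - b)) * (y + (1 + b)) / (1 - b\<^sup>2)" for y
    by (simp add: snr_factor_def power2_eq_square algebra_simps)
  have "((\<lambda>y. (ln (y + (1 - b)) + ln (y + (1 + b)) - ln (1 - b\<^sup>2)) / (2 * ln 2)) has_real_derivative
           (1 / (x + (1 - b)) + 1 / (x + (1 + b))) / (2 * ln 2)) (at x)"
    using assms by (intro DERIV_cdivide) (auto intro!: derivative_eq_intros)
  moreover have "\<forall>\<^sub>F y in nhds x. (ln (y + (1 - b)) + ln (y + (1 + b)) - ln (1 - b\<^sup>2)) / (2 * ln 2)
      = 1/2 * log 2 (snr_factor b y)"
  proof (rule eventually_mono)
    \<comment> \<open>The derivative is two-sided even at \<open>x = 0\<close>, so the splitting of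
      the logarithm must hold slightly below 0; \<open>b - 1 < y\<close> keeps both linear factors
      positive.\<close>
    show "\<forall>\<^sub>F y in nhds x. b - 1 < y"
      using assms by (intro eventually_nhds_in_open[of "{b - 1<..}" x, simplified]) auto
    show "(ln (y + (1 - b)) + ln (y + (1 + b)) - ln (1 - b\<^sup>2)) / (2 * ln 2) = 1/2 * log 2 (snr_factor b y)"
      if "b - 1 < y" for y
      using that assms b unfolding eq by (simp add: log_def ln_div ln_mult)
  qed
  ultimately show ?thesis
    by (subst (asm) DERIV_cong_ev[OF refl _ refl]) auto
qed

text \<open>The weight is the derivative of \<open>1/2 * log 2 (snr_factor b x)\<close>, and both
  conditions hold only for levels up to the point where this function reaches the smaller
  rate.\<close>

lemma nn_integral_log_snr_factor_le_min:
  assumes b: "0 \<le> b" "b < 1" and "0 \<le> u" "0 \<le> B"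
    and u: "\<And>x. 0 \<le> x \<Longrightarrow> P x \<Longrightarrow> 1/2 * log 2 (snr_factor b x) \<le> u"
    and v: "1/2 * log 2 (snr_factor b B) \<le> v"
  shows "(\<integral>\<^sup>+x. ennreal ((1 / (x + (1 - b)) + 1 / (x + (1 + b))) / (2 * ln 2)) * indicator {0..} x *
            ((if P x then 1 else 0) * (if x < B then 1 else 0)) \<partial>lborel) \<le> ennreal (min u v)"
proof -
  let ?\<phi> = "\<lambda>x. 1/2 * log 2 (snr_factor b x)"
  let ?w = "\<lambda>x. (1 / (x + (1 - b)) + 1 / (x + (1 + b))) / (2 * ln 2)"
  have mono: "?\<phi> x < ?\<phi> y" if "0 \<le> x" "x < y" for x y
    using snr_factor_less[OF b that] snr_factor_ge[OF b that(1)] that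
    by (simp add: log_less_cancel_iff)
  have "1 - b\<^sup>2 > 0" using b by (simp add: abs_square_less_1)
  then have \<phi>0: "?\<phi> 0 = 0" by (simp add: snr_factor_def)
  have "continuous_on {0..B} ?\<phi>"
    by (intro continuous_at_imp_continuous_on ballI DERIV_isCont[OF has_derivative_log_snr_factor[OF b]]) auto
  moreover have "0 \<le> ?\<phi> B" using mono[of 0 B] \<phi>0 \<open>0 \<le> B\<close> by (cases "B = 0") auto
  \<comment> \<open>The intermediate value theorem supplies the cut-off level, so no explicit
    inverse of the rate function is needed.\<close>
  ultimately have "\<exists>y\<ge>0. y \<le> B \<and> ?\<phi> y = min u (?\<phi> B)"
    using \<phi>0 \<open>0 \<le> u\<close> \<open>0 \<le> B\<close> by (intro IVT') auto
  then obtain y where y: "0 \<le> y" "y \<le> B" "?\<phi> y = min u (?\<phi> B)" by blast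
  have "x \<le> y" if "0 \<le> x" "P x" "x < B" for x
    using u[OF that(1,2)] mono[OF that(1,3)] mono[OF y(1), of x] y(3) by (cases "x \<le> y") auto
  then have "(\<integral>\<^sup>+x. ennreal (?w x) * indicator {0..} x *
      ((if P x then 1 else 0) * (if x < B then 1 else 0)) \<partial>lborel)
    \<le> (\<integral>\<^sup>+x. ennreal (?w x) * indicator {0..y} x \<partial>lborel)"
    by (intro nn_integral_mono) (auto simp: indicator_def)
  also have "\<dots> = ennreal (?\<phi> y - ?\<phi> 0)"
  proof (rule nn_integral_FTC_Icc)
    fix x assume "x \<in> {0..y}"
    then show "(?\<phi> has_real_derivative ?w x) (at x)" "0 \<le> ?w x"
      using has_derivative_log_snr_factor[OF b, of x] b by auto
  qed (use b y in auto)
  also have "\<dots> \<le> ennreal (min u v)"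
    using y(3) v \<phi>0 by (intro ennreal_leI) auto
  finally show ?thesis .
qed

section \<open>The two hops of the channel and their level probabilities\<close>

locale relay_channel =
  fixes Ps Pr c pi_sr pi_rr pi_rd pi_sd :: real
  assumes pos: "0 < Ps" "0 < Pr" "0 < pi_sr" "0 < pi_rr" "0 < pi_rd" "0 < pi_sd"
    and c: "0 \<le> c" "c < 1"
begin

definition p where "p = Pr * pi_rr"
definition \<beta> where "\<beta> = p * c / (p + 1)"
definition \<delta> where "\<delta> = Pr * pi_rd * (1 - c\<^sup>2)"
definition w where "w x = (1 / (x + (1 - \<beta>)) + 1 / (x + (1 + \<beta>))) / (2 * ln 2)"

text \<open>For nonnegative gains and \<open>0 \<le> x\<close> the truncation event implies that
  \<open>R_sr\<close> is at least the rate at level \<open>x\<close>.\<close>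

definition source_hop :: "real \<Rightarrow> real \<Rightarrow> real \<Rightarrow> ennreal" where
  "source_hop x gsr grr = ennreal (exponential_density (1/pi_rr) grr) *
     (ennreal (exponential_density (1/pi_sr) gsr) *
      (if threshold c p x (Pr * grr) / Ps < gsr then 1 else 0))"

text \<open>For nonnegative gains the truncation event is \<open>x < B\<close>, solved for
  \<open>grd\<close>.\<close>

definition relay_hop :: "real \<Rightarrow> real \<Rightarrow> real \<Rightarrow> ennreal" where
  "relay_hop x grd gsd = ennreal (exponential_density (1/pi_sd) gsd) *
     (ennreal (exponential_density (1/pi_rd) grd) *
      (if x * (Ps * gsd + 1) / (Pr * (1 - c\<^sup>2)) < grd then 1 else 0))"

definition integrand :: "real \<times> real \<times> real \<times> real \<Rightarrow> real" where
  "integrand g = (case g of (gsr, grr, grd, gsd) \<Rightarrow>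
        min (R_sr Ps Pr c gsr grr) (R_rd Ps Pr c grd gsd) *
        (exponential_density (1/pi_sr) gsr * exponential_density (1/pi_rr) grr *
         exponential_density (1/pi_rd) grd * exponential_density (1/pi_sd) gsd))"

lemma p_pos: "0 < p"
  using pos by (simp add: p_def)

lemma \<beta>_bounds: "0 \<le> \<beta>" "\<beta> \<le> c" "\<beta> < 1"
proof -
  show "0 \<le> \<beta>" using p_pos c by (simp add: \<beta>_def)
  show "\<beta> \<le> c" using p_pos c by (simp add: \<beta>_def field_simps)
  then show "\<beta> < 1" using c by simp
qed

lemma c_square_less_1: "c\<^sup>2 < 1"
  using c by (simp add: abs_square_less_1)

lemma \<delta>_pos: "0 < \<delta>"
  using pos c_square_less_1 by (simp add: \<delta>_def)

lemma threshold_measurable [measurable]: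
  assumes [measurable]: "X \<in> borel_measurable M" "R \<in> borel_measurable M"
  shows "(\<lambda>z. threshold c p (X z) (R z)) \<in> borel_measurable M"
  unfolding threshold_def threshold_slope_def snr_factor_def Let_def by measurable

lemma source_hop_measurable [measurable]:
  assumes [measurable]: "X \<in> borel_measurable M" "A \<in> borel_measurable M" "B \<in> borel_measurable M"
  shows "(\<lambda>z. source_hop (X z) (A z) (B z)) \<in> borel_measurable M"
  unfolding source_hop_def by measurable

lemma relay_hop_measurable [measurable]:
  assumes [measurable]: "X \<in> borel_measurable M" "A \<in> borel_measurable M" "B \<in> borel_measurable M"
  shows "(\<lambda>z. relay_hop (X z) (A z) (B z)) \<in> borel_measurable M"
  unfolding relay_hop_def by measurable

lemma integrand_measurable [measurable]: "integrand \<in> borel_measurable borel"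
proof -
  have "integrand \<in> borel_measurable (borel \<Otimes>\<^sub>M borel \<Otimes>\<^sub>M borel \<Otimes>\<^sub>M borel)"
    unfolding integrand_def R_sr_def R_rd_def by measurable
  then show ?thesis by (simp add: borel_prod)
qed

lemma w_measurable [measurable]: "w \<in> borel_measurable borel"
  unfolding w_def by measurable

lemma nn_integral_relay_hop:
  assumes "0 \<le> x"
  shows "(\<integral>\<^sup>+gsd. \<integral>\<^sup>+grd. relay_hop x grd gsd \<partial>lborel \<partial>lborel)
    = ennreal (exp (- x / \<delta>) * (1 / (1 + x * (Ps * pi_sd) / \<delta>)))"
proof -
  have "(\<integral>\<^sup>+grd. relay_hop x grd gsd \<partial>lborel)
     = ennreal (exp (- x / \<delta>)) * (ennreal (exponential_density (1/pi_sd) gsd) * ennreal (exp (- (x * Ps / \<delta>) * gsd)))"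
    for gsd
  proof (cases "0 \<le> gsd")
    case True
    have "exp (- (1 / pi_rd) * (x * (Ps * gsd + 1) / (Pr * (1 - c\<^sup>2)))) = exp (- x / \<delta>) * exp (- (x * Ps / \<delta>) * gsd)"
      unfolding exp_add[symmetric] using pos c_square_less_1 by (simp add: \<delta>_def divide_simps) (simp add: algebra_simps)?
    moreover have "(\<integral>\<^sup>+grd. relay_hop x grd gsd \<partial>lborel)
      = ennreal (exponential_density (1/pi_sd) gsd) *
        ennreal (exp (- (1 / pi_rd) * (x * (Ps * gsd + 1) / (Pr * (1 - c\<^sup>2)))))"
      using True assms pos c_square_less_1 unfolding relay_hop_def
      by (subst nn_integral_cmult, simp, subst nn_integral_exponential_density_tail) auto
    ultimately show ?thesis by (simp add: ennreal_mult mult_ac)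
  qed (simp add: relay_hop_def exponential_density_def)
  then have "(\<integral>\<^sup>+gsd. \<integral>\<^sup>+grd. relay_hop x grd gsd \<partial>lborel \<partial>lborel)
    = ennreal (exp (- x / \<delta>)) * ennreal (1 / pi_sd / (1 / pi_sd + x * Ps / \<delta>))"
    using pos \<delta>_pos assms
    by (simp only:) (subst nn_integral_cmult, simp, subst nn_integral_exponential_density_exp, auto intro!: add_pos_nonneg)
  also have "1 / pi_sd / (1 / pi_sd + x * Ps / \<delta>) = 1 / (1 + x * (Ps * pi_sd) / \<delta>)"
    using pos \<delta>_pos assms by (simp add: field_simps)
  finally show ?thesis
    using pos \<delta>_pos assms by (simp only: ennreal_mult'[symmetric] exp_ge_zero)
qed

text \<open>The tail in \<open>gsr\<close> is exponential in an affine function of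
  \<open>grr\<close>. Centring the tangent at \<open>p\<close> contributes \<open>exp u\<close>,
  averaging over \<open>grr\<close> contributes \<open>1 / (1 + u)\<close>, and their product is at
  least 1.\<close>

lemma nn_integral_source_hop_ge:
  assumes "0 \<le> x"
  shows "ennreal (exp (- x * ((p + 1) / (Ps * pi_sr)))) \<le> (\<integral>\<^sup>+grr. \<integral>\<^sup>+gsr. source_hop x gsr grr \<partial>lborel \<partial>lborel)"
proof -
  define S where "S = Ps * pi_sr"
  define k where "k = threshold_slope c p x"
  define u where "u = k * p / S"
  have S: "0 < S" using pos by (simp add: S_def)
  have k: "0 \<le> k" using threshold_slope_props(4)[OF c p_pos assms] by (simp add: k_def)
  have u: "0 \<le> u" using k S p_pos by (simp add: u_def)
  have "(\<integral>\<^sup>+gsr. source_hop x gsr grr \<partial>lborel)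
     = ennreal (exp (- x * ((p + 1) / S) + u)) *
       (ennreal (exponential_density (1/pi_rr) grr) * ennreal (exp (- (k * Pr / S) * grr)))"
    for grr
  proof (cases "0 \<le> grr")
    case True
    have t: "0 \<le> threshold c p x (Pr * grr) / Ps"
      using threshold_nonneg[OF c p_pos assms] True pos by simp
    have "exp (- (1 / pi_sr) * (threshold c p x (Pr * grr) / Ps))
      = exp (- x * ((p + 1) / S) + u) * exp (- (k * Pr / S) * grr)"
      unfolding exp_add[symmetric] using pos by (simp add: threshold_def k_def u_def S_def divide_simps) (simp add: algebra_simps)?
    moreover have "(\<integral>\<^sup>+gsr. source_hop x gsr grr \<partial>lborel)
      = ennreal (exponential_density (1/pi_rr) grr) *
        ennreal (exp (- (1 / pi_sr) * (threshold c p x (Pr * grr) / Ps)))"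
      using t pos unfolding source_hop_def
      by (subst nn_integral_cmult, simp, subst nn_integral_exponential_density_tail) auto
    ultimately show ?thesis by (simp add: ennreal_mult mult_ac)
  qed (simp add: source_hop_def exponential_density_def)
  then have "(\<integral>\<^sup>+grr. \<integral>\<^sup>+gsr. source_hop x gsr grr \<partial>lborel \<partial>lborel)
    = ennreal (exp (- x * ((p + 1) / S) + u)) * ennreal (1 / pi_rr / (1 / pi_rr + k * Pr / S))"
    using pos S k
    by (simp only:) (subst nn_integral_cmult, simp, subst nn_integral_exponential_density_exp, auto intro!: add_pos_nonneg)
  also have "1 / pi_rr / (1 / pi_rr + k * Pr / S) = 1 / (1 + u)"
    using pos S k by (simp add: u_def p_def field_simps)
  also have "ennreal (exp (- x * ((p + 1) / S) + u)) * ennreal (1 / (1 + u))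
     = ennreal (exp (- x * ((p + 1) / S)) * (exp u / (1 + u)))"
    unfolding exp_add using u by (simp add: ennreal_mult[symmetric])
  also have "exp (- x * ((p + 1) / S)) * (exp u / (1 + u)) \<ge> exp (- x * ((p + 1) / S)) * 1"
    using u exp_ge_add_one_self[of u] by (intro mult_left_mono) auto
  ultimately show ?thesis by (simp add: S_def ennreal_leI)
qed

lemma R_sr_ge:
  assumes "0 \<le> gsr" "0 \<le> grr" "0 \<le> x" "threshold c p x (Pr * grr) / Ps < gsr"
  shows "1/2 * log 2 (snr_factor \<beta> x) \<le> R_sr Ps Pr c gsr grr"
proof -
  have "threshold c p x (Pr * grr) \<le> Ps * gsr"
    using assms pos by (simp add: pos_divide_less_eq mult.commute)
  then have "snr_factor \<beta> x \<le> ((Ps * gsr + Pr * grr + 1)\<^sup>2 - (Pr * grr * c)\<^sup>2) / ((Pr * grr + 1)\<^sup>2 - (Pr * grr * c)\<^sup>2)"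
    unfolding \<beta>_def using assms pos by (intro snr_factor_le_sr[OF c p_pos]) auto
  moreover have "0 < snr_factor \<beta> x"
    using snr_factor_ge[OF \<beta>_bounds(1,3) assms(3)] assms by linarith
  ultimately show ?thesis unfolding R_sr_def by simp
qed

lemma R_rd_ge:
  assumes "0 \<le> grd" "0 \<le> gsd"
  shows "1/2 * log 2 (snr_factor \<beta> (Pr * grd * (1 - c\<^sup>2) / (Ps * gsd + 1))) \<le> R_rd Ps Pr c grd gsd"
proof -
  let ?B = "Pr * grd * (1 - c\<^sup>2) / (Ps * gsd + 1)"
  have "0 \<le> ?B" using assms pos c_square_less_1 by simp
  then have "0 < snr_factor \<beta> ?B"
    using snr_factor_ge[OF \<beta>_bounds(1,3), of ?B] by linarith
  moreover have "snr_factor \<beta> ?B \<le> ((Pr * grd + Ps * gsd + 1)\<^sup>2 - (Pr * grd * c)\<^sup>2) / (Ps * gsd + 1)\<^sup>2"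
    using assms pos c \<beta>_bounds by (intro snr_factor_le_rd) auto
  ultimately show ?thesis unfolding R_rd_def by simp
qed

lemma R_sr_nonneg:
  assumes "0 \<le> gsr" "0 \<le> grr"
  shows "0 \<le> R_sr Ps Pr c gsr grr"
proof -
  have "Pr * grr * c \<le> Pr * grr * 1" using assms pos c by (intro mult_left_mono) auto
  then have "Pr * grr * c < Pr * grr + 1" by linarith
  then have "(Pr * grr * c)\<^sup>2 < (Pr * grr + 1)\<^sup>2"
    using assms pos c by (intro power_strict_mono) auto
  then have "0 < (Pr * grr + 1)\<^sup>2 - (Pr * grr * c)\<^sup>2" by simp
  moreover have "(Pr * grr + 1)\<^sup>2 \<le> (Ps * gsr + Pr * grr + 1)\<^sup>2"
    using assms pos by (intro power_mono) auto
  ultimately show ?thesis unfolding R_sr_def by simp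
qed

text \<open>A linear majorant from \<open>ln (1 + d) \<le> d\<close>; it serves to show that the
  ergodic rate is finite.\<close>

lemma R_rd_le:
  assumes "0 \<le> grd" "0 \<le> gsd"
  shows "R_rd Ps Pr c grd gsd \<le> Pr * grd / ln 2"
proof -
  define d q where "d = Pr * grd" and "q = Ps * gsd + 1"
  have d: "0 \<le> d" "1 \<le> q" using assms pos by (auto simp: d_def q_def)
  have "d * c \<le> d * 1" using d c by (intro mult_left_mono) auto
  then have "(d * c)\<^sup>2 < (d + q)\<^sup>2" using d c by (intro power_strict_mono) auto
  then have "0 < ((d + q)\<^sup>2 - (d * c)\<^sup>2) / q\<^sup>2" using d by simp
  moreover have "((d + q)\<^sup>2 - (d * c)\<^sup>2) / q\<^sup>2 \<le> ((d + q) / q)\<^sup>2"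
    using d by (simp add: power_divide divide_right_mono)
  moreover have "((d + q) / q)\<^sup>2 \<le> (1 + d)\<^sup>2"
    using d mult_left_mono[of 1 q d] by (intro power_mono) (auto simp: field_simps)
  ultimately have "0 < ((d + q)\<^sup>2 - (d * c)\<^sup>2) / q\<^sup>2" "((d + q)\<^sup>2 - (d * c)\<^sup>2) / q\<^sup>2 \<le> (1 + d)\<^sup>2"
    by linarith+
  then have "log 2 (((d + q)\<^sup>2 - (d * c)\<^sup>2) / q\<^sup>2) \<le> log 2 ((1 + d)\<^sup>2)"
    using d by (subst log_le_cancel_iff) auto
  also have "\<dots> = 2 * (ln (1 + d) / ln 2)"
    using d by (simp add: log_def ln_realpow)
  also have "ln (1 + d) / ln 2 \<le> d / ln 2"
    using d by (intro divide_right_mono ln_add_one_self_le_self) auto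
  finally show ?thesis by (simp add: R_rd_def d_def q_def add.assoc mult.commute)
qed

section \<open>Lower bound and finiteness of the ergodic integral\<close>

text \<open>For fixed gains the densities do not depend on \<open>x\<close> and factor out, which
  leaves the layer-cake bound for the minimum of the rates. If some gain is negative, a density
  vanishes.\<close>

lemma integrand_ge_hops:
  "(\<integral>\<^sup>+x. ennreal (w x) * indicator {0..} x * (source_hop x gsr grr * relay_hop x grd gsd) \<partial>lborel)
     \<le> ennreal (integrand (gsr, grr, grd, gsd))"
proof (cases "0 \<le> gsr \<and> 0 \<le> grr \<and> 0 \<le> grd \<and> 0 \<le> gsd")
  case False
  then have "source_hop x gsr grr * relay_hop x grd gsd = 0" for x
    by (auto simp: source_hop_def relay_hop_def exponential_density_def)
  then show ?thesis by (simp only: mult_zero_right nn_integral_const) simp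
next
  case True
  define dens where "dens = exponential_density (1/pi_sr) gsr * exponential_density (1/pi_rr) grr *
         exponential_density (1/pi_rd) grd * exponential_density (1/pi_sd) gsd"
  have dens: "0 \<le> dens" using pos by (simp add: dens_def exponential_density_nonneg)
  define B where "B = Pr * grd * (1 - c\<^sup>2) / (Ps * gsd + 1)"
  have B: "x * (Ps * gsd + 1) / (Pr * (1 - c\<^sup>2)) < grd \<longleftrightarrow> x < B" for x
  proof -
    have "0 < Ps * gsd + 1" using True pos by (intro add_nonneg_pos) auto
    then show ?thesis
      using pos c_square_less_1 by (simp add: B_def pos_divide_less_eq pos_less_divide_eq mult_ac)
  qed
  let ?P = "\<lambda>x. threshold c p x (Pr * grr) / Ps < gsr"
  have "source_hop x gsr grr * relay_hop x grd gsd
    = ennreal dens * ((if ?P x then 1 else 0) * (if x < B then 1 else 0))" for x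
    unfolding source_hop_def relay_hop_def B dens_def
    using pos by (simp add: ennreal_mult exponential_density_nonneg mult_ac)
  then have "(\<integral>\<^sup>+x. ennreal (w x) * indicator {0..} x * (source_hop x gsr grr * relay_hop x grd gsd) \<partial>lborel)
    = (\<integral>\<^sup>+x. ennreal dens * (ennreal (w x) * indicator {0..} x *
        ((if ?P x then 1 else 0) * (if x < B then 1 else 0))) \<partial>lborel)"
    by (simp add: mult_ac)
  also have "\<dots> = ennreal dens * (\<integral>\<^sup>+x. ennreal (w x) * indicator {0..} x *
        ((if ?P x then 1 else 0) * (if x < B then 1 else 0)) \<partial>lborel)"
    by (rule nn_integral_cmult) measurable
  also have "\<dots> \<le> ennreal dens * ennreal (min (R_sr Ps Pr c gsr grr) (R_rd Ps Pr c grd gsd))"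
  proof (rule mult_left_mono)
    show "(\<integral>\<^sup>+x. ennreal (w x) * indicator {0..} x *
        ((if ?P x then 1 else 0) * (if x < B then 1 else 0)) \<partial>lborel)
      \<le> ennreal (min (R_sr Ps Pr c gsr grr) (R_rd Ps Pr c grd gsd))"
      unfolding w_def
    proof (rule nn_integral_log_snr_factor_le_min)
      show "0 \<le> B" using True pos c_square_less_1 by (simp add: B_def)
    qed (use True \<beta>_bounds R_sr_ge R_rd_ge R_sr_nonneg in \<open>auto simp: B_def\<close>)
  qed simp
  also have "\<dots> = ennreal (integrand (gsr, grr, grd, gsd))"
    unfolding ennreal_mult'[OF dens, symmetric] by (simp add: integrand_def dens_def mult_ac)
  finally show ?thesis .
qed

text \<open>Tonelli exchanges the level \<open>x\<close> with the gains; at a fixed level the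
  integral over the gains is the product of the two hop probabilities.\<close>

lemma nn_integral_integrand_ge:
  "(\<integral>\<^sup>+x. ennreal (indicator {0..} x * (w x * exp (- x * ((p + 1) / (Ps * pi_sr))) *
       (exp (- x / \<delta>) * (1 / (1 + x * (Ps * pi_sd) / \<delta>))))) \<partial>lborel)
     \<le> (\<integral>\<^sup>+g. ennreal (integrand g) \<partial>lborel)" (is "?L \<le> ?N")
proof -
  let ?F = "\<lambda>x. \<integral>\<^sup>+grr. \<integral>\<^sup>+gsr. source_hop x gsr grr \<partial>lborel \<partial>lborel"
  let ?G = "\<lambda>x. \<integral>\<^sup>+gsd. \<integral>\<^sup>+grd. relay_hop x grd gsd \<partial>lborel \<partial>lborel"
  let ?h = "\<lambda>x g. case g of (gsr, grr, grd, gsd) \<Rightarrow> source_hop x gsr grr * relay_hop x grd gsd"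
  let ?w = "\<lambda>x. ennreal (w x) * indicator {0..} x"
  have "(\<lambda>(x, g). ?h x g) \<in> borel_measurable (borel \<Otimes>\<^sub>M borel \<Otimes>\<^sub>M borel \<Otimes>\<^sub>M borel \<Otimes>\<^sub>M borel)"
    by measurable
  then have m[measurable]: "(\<lambda>(x, g). ?h x g) \<in> borel_measurable (borel \<Otimes>\<^sub>M borel)"
    by (simp add: borel_prod)
  have "?L \<le> (\<integral>\<^sup>+x. ?w x * (?F x * ?G x) \<partial>lborel)"
  proof (rule nn_integral_mono)
    fix x :: real
    show "ennreal (indicator {0..} x * (w x * exp (- x * ((p + 1) / (Ps * pi_sr))) *
       (exp (- x / \<delta>) * (1 / (1 + x * (Ps * pi_sd) / \<delta>))))) \<le> ?w x * (?F x * ?G x)"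
    proof (cases "0 \<le> x")
      case True
      have "0 \<le> w x" using True \<beta>_bounds by (simp add: w_def)
      moreover have "0 \<le> exp (- x / \<delta>) * (1 / (1 + x * (Ps * pi_sd) / \<delta>))"
        using True pos \<delta>_pos by simp
      ultimately have "ennreal (indicator {0..} x * (w x * exp (- x * ((p + 1) / (Ps * pi_sr))) *
          (exp (- x / \<delta>) * (1 / (1 + x * (Ps * pi_sd) / \<delta>)))))
        = ennreal (w x) * (ennreal (exp (- x * ((p + 1) / (Ps * pi_sr)))) * ?G x)"
        unfolding nn_integral_relay_hop[OF True]
        using True by (simp only: ennreal_mult[symmetric] mult_nonneg_nonneg exp_ge_zero indicator_def) (simp add: mult_ac)
      also have "\<dots> \<le> ennreal (w x) * (?F x * ?G x)"
        by (intro mult_left_mono mult_right_mono nn_integral_source_hop_ge[OF True]) auto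
      finally show ?thesis using True by simp
    qed simp
  qed
  also have "\<dots> = (\<integral>\<^sup>+x. \<integral>\<^sup>+g. ?w x * ?h x g \<partial>lborel \<partial>lborel)"
  proof (rule nn_integral_cong)
    fix x :: real
    have "?F x * ?G x = (\<integral>\<^sup>+g. ?h x g \<partial>lborel)"
      by (rule nn_integral_lborel_prod4_times[symmetric]) measurable
    then show "?w x * (?F x * ?G x) = (\<integral>\<^sup>+g. ?w x * ?h x g \<partial>lborel)"
      by (simp add: nn_integral_cmult)
  qed
  also have "\<dots> = (\<integral>\<^sup>+g. \<integral>\<^sup>+x. ?w x * ?h x g \<partial>lborel \<partial>lborel)"
    by (rule lborel_pair.Fubini'[symmetric]) measurable
  also have "\<dots> \<le> ?N"
    by (intro nn_integral_mono) (auto simp: integrand_ge_hops split: prod.split)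
  finally show ?thesis .
qed

text \<open>Finiteness excludes the default value 0 that \<open>enn2real\<close> assigns to
  infinity, which would invalidate a lower bound on the Bochner integral.\<close>

lemma nn_integral_integrand_finite: "(\<integral>\<^sup>+g. ennreal (integrand g) \<partial>lborel) < \<infinity>"
proof -
  let ?e = "\<lambda>l t. ennreal (exponential_density (1/l) t)"
  \<comment> \<open>The linear bound on \<open>R_rd\<close> is replaced by
    \<open>?C * exp (grd / (2 * pi_rd))\<close>. This exponential uses up half the decay rate of the
    density of \<open>grd\<close>, so that its expectation is 2.\<close>
  let ?C = "2 * pi_rd * Pr / ln 2"
  let ?F = "\<lambda>a b. ?e pi_rr b * ?e pi_sr a"
  let ?G = "\<lambda>a b. ennreal ?C * (?e pi_sd b * (?e pi_rd a * ennreal (exp (- (- 1 / (2 * pi_rd)) * a))))"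
  have "ennreal (integrand g) \<le> (case g of (a, b, c, d) \<Rightarrow> ?F a b * ?G c d)" for g
  proof (cases g)
    case (fields gsr grr grd gsd)
    show ?thesis
    proof (cases "0 \<le> gsr \<and> 0 \<le> grr \<and> 0 \<le> grd \<and> 0 \<le> gsd")
      case False
      then show ?thesis by (auto simp: fields integrand_def exponential_density_def)
    next
      case True
      have "grd / (2 * pi_rd) \<le> exp (grd / (2 * pi_rd))"
        using exp_ge_add_one_self[of "grd / (2 * pi_rd)"] by linarith
      then have "?C * (grd / (2 * pi_rd)) \<le> ?C * exp (grd / (2 * pi_rd))"
        using pos by (intro mult_left_mono) auto
      moreover have "?C * (grd / (2 * pi_rd)) = Pr * grd / ln 2" using pos by simp
      ultimately have "min (R_sr Ps Pr c gsr grr) (R_rd Ps Pr c grd gsd) \<le> ?C * exp (grd / (2 * pi_rd))"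
        using R_rd_le[of grd gsd] True by linarith
      then have "integrand g \<le> ?C * exp (grd / (2 * pi_rd)) *
        (exponential_density (1/pi_sr) gsr * exponential_density (1/pi_rr) grr *
         exponential_density (1/pi_rd) grd * exponential_density (1/pi_sd) gsd)"
        unfolding integrand_def fields prod.case
        using pos by (intro mult_right_mono) (auto simp: exponential_density_nonneg)
      also have "ennreal \<dots> = ?F gsr grr * ?G grd gsd"
        using pos by (simp add: ennreal_mult[symmetric] exponential_density_nonneg mult_ac)
      finally show ?thesis by (simp add: fields ennreal_leI)
    qed
  qed
  then have "(\<integral>\<^sup>+g. ennreal (integrand g) \<partial>lborel) \<le> (\<integral>\<^sup>+g. (case g of (a, b, c, d) \<Rightarrow> ?F a b * ?G c d) \<partial>lborel)"
    by (rule nn_integral_mono)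
  also have "\<dots> = (\<integral>\<^sup>+b. \<integral>\<^sup>+a. ?F a b \<partial>lborel \<partial>lborel) * (\<integral>\<^sup>+d. \<integral>\<^sup>+c. ?G c d \<partial>lborel \<partial>lborel)"
    by (rule nn_integral_lborel_prod4_times) measurable
  also have "(\<integral>\<^sup>+b. \<integral>\<^sup>+a. ?F a b \<partial>lborel \<partial>lborel) = 1"
    using pos by (simp add: nn_integral_cmult nn_integral_exponential_density)
  also have "(\<integral>\<^sup>+a. ?e pi_rd a * ennreal (exp (- (- 1 / (2 * pi_rd)) * a)) \<partial>lborel) = ennreal 2"
    using pos by (subst nn_integral_exponential_density_exp) (auto simp: field_simps)
  then have "(\<integral>\<^sup>+c. ?G c d \<partial>lborel) = ennreal ?C * (?e pi_sd d * ennreal 2)" for d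
    by (subst nn_integral_cmult, measurable, subst nn_integral_cmult, measurable)
  then have "(\<integral>\<^sup>+d. \<integral>\<^sup>+c. ?G c d \<partial>lborel \<partial>lborel) = ennreal ?C * ennreal 2"
    using pos by (simp only:) (subst nn_integral_cmult, measurable,
      subst nn_integral_multc, measurable, simp add: nn_integral_exponential_density)
  finally show ?thesis by (simp add: ennreal_mult_less_top order_le_less_trans)
qed

section \<open>Partial fractions and evaluation by \<open>Xi1\<close>\<close>

text \<open>The poles are \<open>-(1 - \<beta>)\<close> and \<open>-(1 + \<beta>)\<close> from
  \<open>w\<close> and \<open>- \<delta> / Q\<close> from the relay hop. The assumptions
  \<open>ne\<close> separate the last one from the first two, and each simple fraction yields one
  \<open>Xi1\<close> term.\<close>

lemma nn_integral_hops_eq: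
  fixes \<mu> Q \<kappa>1 \<kappa>2 \<kappa>3 :: real
  defines "\<mu> \<equiv> (p + 1) / (Ps * pi_sr) + 1 / \<delta>"
    and "Q \<equiv> Ps * pi_sd"
    and "\<kappa>1 \<equiv> 0.5 * Q / (\<delta> - Q * (1 - \<beta>))"
    and "\<kappa>2 \<equiv> 0.5 * Q / (\<delta> - Q * (1 + \<beta>))"
    and "\<kappa>3 \<equiv> Q * (Q - \<delta>) / ((\<delta> - Q * (1 - \<beta>)) * (\<delta> - Q * (1 + \<beta>)))"
  assumes ne: "\<delta> \<noteq> Q * (1 - \<beta>)" "\<delta> \<noteq> Q * (1 + \<beta>)"
  shows "(\<integral>\<^sup>+x. ennreal (indicator {0..} x * (w x * exp (- x * ((p + 1) / (Ps * pi_sr))) *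
       (exp (- x / \<delta>) * (1 / (1 + x * (Ps * pi_sd) / \<delta>))))) \<partial>lborel)
    = ennreal (\<delta> / (Q * ln 2) * (\<kappa>1 * Xi1 (\<mu> * (1 - \<beta>)) + \<kappa>2 * Xi1 (\<mu> * (1 + \<beta>)) + \<kappa>3 * Xi1 (\<mu> * (\<delta> / Q))))"
proof -
  define I where "I b x = indicator {0..} x * (exp (- \<mu> * x) / (x + b))" for b x :: real
  have Q: "0 < Q" using pos by (simp add: Q_def)
  have \<mu>: "0 < \<mu>" using pos p_pos \<delta>_pos by (simp add: \<mu>_def add_pos_pos)
  have bs: "0 < 1 - \<beta>" "0 < 1 + \<beta>" "0 < \<delta> / Q" using \<beta>_bounds \<delta>_pos Q by auto
  define H where "H x = \<delta> / (Q * ln 2) * (\<kappa>1 * I (1 - \<beta>) x + \<kappa>2 * I (1 + \<beta>) x + \<kappa>3 * I (\<delta> / Q) x)" for x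
  let ?f = "\<lambda>x. indicator {0..} x * (w x * exp (- x * ((p + 1) / (Ps * pi_sr))) *
       (exp (- x / \<delta>) * (1 / (1 + x * (Ps * pi_sd) / \<delta>))))"
  \<comment> \<open>Both partial fraction splittings share the pole \<open>- \<delta> / Q\<close>,
    so its coefficients add up to \<open>\<kappa>3\<close>.\<close>
  have k3: "\<kappa>3 = - (\<kappa>1 + \<kappa>2)"
    using ne by (simp add: \<kappa>1_def \<kappa>2_def \<kappa>3_def divide_simps) (simp add: algebra_simps)?
  have pf: "0.5 * (1 / (x + a)) * (\<delta> / (\<delta> + x * Q)) = \<delta> / Q * (0.5 * Q / (\<delta> - Q * a) * (1 / (x + a) - 1 / (x + \<delta> / Q)))"
    if "0 \<le> x" "0 < a" "\<delta> \<noteq> Q * a" for x a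
  proof -
    define e where "e = \<delta> - Q * a"
    have z: "x + a \<noteq> 0" "\<delta> + x * Q \<noteq> 0" "e \<noteq> 0"
      using that Q \<delta>_pos by (auto simp: e_def add_pos_nonneg less_imp_neq[symmetric])
    have "1 / (x + \<delta> / Q) = Q / (\<delta> + x * Q)" using Q by (simp add: field_simps)
    moreover have "1 / (x + a) - Q / (\<delta> + x * Q) = e / ((x + a) * (\<delta> + x * Q))"
      using z by (simp add: e_def diff_frac_eq algebra_simps)
    ultimately show ?thesis
      using z Q by (simp add: e_def[symmetric])
  qed
  have fH: "?f x = H x" for x
  proof (cases "0 \<le> x")
    case True
    \<comment> \<open>Here \<open>E1\<close> is a local name for an exponential factor and hides the
      exponential integral.\<close>
    define E1 E2 where "E1 = exp (- x * ((p + 1) / (Ps * pi_sr)))" and "E2 = exp (- x / \<delta>)"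
    have "- x * m + - x / \<delta> = - (m + 1 / \<delta>) * x" for m
      by (simp add: algebra_simps)
    then have E: "E1 * E2 = exp (- \<mu> * x)"
      unfolding E1_def E2_def exp_add[symmetric] \<mu>_def by (simp only:)
    have G: "1 / (1 + x * (Ps * pi_sd) / \<delta>) = \<delta> / (\<delta> + x * Q)"
      using \<delta>_pos by (simp add: Q_def[symmetric] field_simps)
    have alg: "(A + B) / (2 * l) * E1 * (E2 * G) = E1 * E2 / l * (0.5 * A * G + 0.5 * B * G)" for A B l G :: real
      by (simp add: add_divide_distrib algebra_simps)
    have "?f x = w x * E1 * (E2 * (1 / (1 + x * (Ps * pi_sd) / \<delta>)))"
      using True by (simp add: E1_def E2_def)
    also have "\<dots> = exp (- \<mu> * x) / ln 2 *
       (0.5 * (1 / (x + (1 - \<beta>))) * (\<delta> / (\<delta> + x * Q)) + 0.5 * (1 / (x + (1 + \<beta>))) * (\<delta> / (\<delta> + x * Q)))"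
      unfolding w_def G alg E ..
    also have "\<dots> = exp (- \<mu> * x) / ln 2 * (\<delta> / Q *
       (\<kappa>1 * (1 / (x + (1 - \<beta>)) - 1 / (x + \<delta> / Q)) + \<kappa>2 * (1 / (x + (1 + \<beta>)) - 1 / (x + \<delta> / Q))))"
      unfolding pf[OF True bs(1) ne(1), folded \<kappa>1_def] pf[OF True bs(2) ne(2), folded \<kappa>2_def]
      by (simp only: distrib_left)
    also have "E / l * (d / q * (k1 * (1 / u - 1 / z) + k2 * (1 / v - 1 / z)))
      = d / (q * l) * (k1 * (E / u) + k2 * (E / v) + - (k1 + k2) * (E / z))" for E l d q k1 k2 u v z :: real
      by (simp add: add_divide_distrib diff_divide_distrib algebra_simps)
    also have "\<delta> / (Q * ln 2) * (\<kappa>1 * (exp (- \<mu> * x) / (x + (1 - \<beta>))) + \<kappa>2 * (exp (- \<mu> * x) / (x + (1 + \<beta>))) +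
        - (\<kappa>1 + \<kappa>2) * (exp (- \<mu> * x) / (x + \<delta> / Q))) = H x"
      unfolding H_def I_def k3 using True by simp
    finally show ?thesis .
  qed (simp add: H_def I_def)
  note I = Xi1_eq_integral[OF \<mu>, folded I_def]
  \<comment> \<open>The coefficients in \<open>H\<close> may have either sign, so nonnegativity is
    read off from the product form.\<close>
  have f_nonneg: "0 \<le> ?f x" for x
  proof (cases "0 \<le> x")
    case True
    then have "0 \<le> w x" using \<beta>_bounds by (simp add: w_def)
    then show ?thesis using True pos \<delta>_pos by simp
  qed simp
  have "(\<integral>\<^sup>+x. ennreal (?f x) \<partial>lborel) = (\<integral>\<^sup>+x. ennreal (H x) \<partial>lborel)"
    by (simp only: fH)
  also have "\<dots> = ennreal (\<integral>x. H x \<partial>lborel)"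
  proof (rule nn_integral_eq_integral)
    show "integrable lborel H"
      unfolding H_def using I(1) bs by auto
    show "AE x in lborel. 0 \<le> H x"
      using f_nonneg unfolding fH by simp
  qed
  also have "(\<integral>x. H x \<partial>lborel) = \<delta> / (Q * ln 2) *
     (\<kappa>1 * Xi1 (\<mu> * (1 - \<beta>)) + \<kappa>2 * Xi1 (\<mu> * (1 + \<beta>)) + \<kappa>3 * Xi1 (\<mu> * (\<delta> / Q)))"
    unfolding H_def using I bs by simp
  finally show ?thesis .
qed

text \<open>Passage from the nonnegative integral to the Bochner integral, which needs a nonnegative
  integrand and a finite integral.\<close>

lemma ergodic_rate_EE_ge:
  assumes "ennreal t \<le> (\<integral>\<^sup>+g. ennreal (integrand g) \<partial>lborel)"
  shows "t \<le> ergodic_rate_EE Ps Pr c pi_sr pi_rr pi_rd pi_sd"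
proof -
  have nonneg: "0 \<le> integrand g" for g
  proof (cases g)
    case (fields gsr grr grd gsd)
    show ?thesis
    proof (cases "0 \<le> gsr \<and> 0 \<le> grr \<and> 0 \<le> grd \<and> 0 \<le> gsd")
      case False
      then show ?thesis by (auto simp: fields integrand_def exponential_density_def)
    next
      case True
      let ?B = "Pr * grd * (1 - c\<^sup>2) / (Ps * gsd + 1)"
      have "0 \<le> ?B" using True pos c_square_less_1 by simp
      then have "1 \<le> snr_factor \<beta> ?B"
        using snr_factor_ge[OF \<beta>_bounds(1,3), of ?B] by linarith
      then have "0 \<le> 1/2 * log 2 (snr_factor \<beta> ?B)" by simp
      also have "\<dots> \<le> R_rd Ps Pr c grd gsd" using True by (intro R_rd_ge) auto
      finally show ?thesis
        using True R_sr_nonneg[of gsr grr] pos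
        by (simp add: fields integrand_def exponential_density_nonneg)
    qed
  qed
  have "ergodic_rate_EE Ps Pr c pi_sr pi_rr pi_rd pi_sd = integral\<^sup>L lborel integrand"
    unfolding ergodic_rate_EE_def integrand_def ..
  also have "\<dots> = enn2real (\<integral>\<^sup>+g. ennreal (integrand g) \<partial>lborel)"
    using nonneg by (intro integral_eq_nn_integral) auto
  finally have e: "ergodic_rate_EE Ps Pr c pi_sr pi_rr pi_rd pi_sd = \<dots>" .
  have "ennreal t \<le> ennreal (enn2real (\<integral>\<^sup>+g. ennreal (integrand g) \<partial>lborel))"
    using assms nn_integral_integrand_finite by simp
  then show ?thesis
    unfolding e by (subst (asm) ennreal_le_iff) auto
qed

end

section \<open>Translation to the constants of the stated bound\<close>

theorem theorem8:
  fixes Ps Pr Cx pi_sr pi_rr pi_rd pi_sd :: real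
  assumes "Ps > 0" "Pr > 0"
    and "pi_sr > 0" "pi_rr > 0" "pi_rd > 0" "pi_sd > 0"
    and "0 \<le> Cx" "Cx < 1"
  defines "\<alpha> \<equiv> Pr * pi_rr / (Pr * pi_rr + 1)"
  defines "a \<equiv> (\<lambda>i::nat. 1 + (-1)^i * \<alpha> * Cx)"
  defines "D \<equiv> Pr * pi_rd * (1 - Cx^2)"
  defines "\<kappa> \<equiv> (\<lambda>i::nat. 0.5 * Ps * pi_sd / (D - Ps * pi_sd * a i))"
  defines "\<kappa>3 \<equiv> Ps * pi_sd * (Ps * pi_sd - D) /
                 ((D - Ps * pi_sd * (1 - \<alpha> * Cx)) * (D - Ps * pi_sd * (1 + \<alpha> * Cx)))"
  assumes "\<forall>i\<in>{1,2}. D \<noteq> Ps * pi_sd * a i"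
  shows "ergodic_rate_EE Ps Pr Cx pi_sr pi_rr pi_rd pi_sd \<ge>
    D / (Ps * pi_sd * ln 2) *
      ((\<Sum>i\<in>{1,2}. \<kappa> i * Xi1 (Pr * pi_rr * a i / (\<alpha> * Ps * pi_sr) + a i / D))
       + \<kappa>3 * Xi1 (Pr^2 * pi_rd * pi_rr * (1 - Cx^2) / (\<alpha> * Ps^2 * pi_sd * pi_sr)
                    + 1 / (Ps * pi_sd)))"
proof -
  interpret relay_channel Ps Pr Cx pi_sr pi_rr pi_rd pi_sd
    using assms by unfold_locales
  have \<beta>: "\<beta> = \<alpha> * Cx" by (simp add: \<beta>_def p_def \<alpha>_def)
  have D: "\<delta> = D" by (simp add: \<delta>_def D_def)
  have a: "a 1 = 1 - \<beta>" "a 2 = 1 + \<beta>" by (simp_all add: a_def \<beta>)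
  define \<mu> where "\<mu> = (p + 1) / (Ps * pi_sr) + 1 / \<delta>"
  \<comment> \<open>This identity turns all three arguments of \<open>Xi1\<close> into
    \<open>\<mu>\<close> times the corresponding pole offset.\<close>
  have r: "Pr * pi_rr / \<alpha> = p + 1" using pos p_pos by (simp add: \<alpha>_def p_def)
  have arg: "Pr * pi_rr * y / (\<alpha> * Ps * pi_sr) + y / D = \<mu> * y" for y
  proof -
    have "Pr * pi_rr * y / (\<alpha> * Ps * pi_sr) = (Pr * pi_rr / \<alpha>) * y / (Ps * pi_sr)" by simp
    then show ?thesis unfolding r by (simp add: \<mu>_def D algebra_simps)
  qed
  have "Pr^2 * pi_rd * pi_rr * (1 - Cx^2) / (\<alpha> * Ps^2 * pi_sd * pi_sr)
      = (Pr * pi_rr / \<alpha>) / (Ps * pi_sr) * (D / (Ps * pi_sd))"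
    by (simp add: D_def power2_eq_square mult_ac)
  then have arg3: "Pr^2 * pi_rd * pi_rr * (1 - Cx^2) / (\<alpha> * Ps^2 * pi_sd * pi_sr) + 1 / (Ps * pi_sd)
      = \<mu> * (\<delta> / (Ps * pi_sd))"
    unfolding r using \<delta>_pos by (simp add: \<mu>_def D algebra_simps)
  have ne: "\<delta> \<noteq> Ps * pi_sd * (1 - \<beta>)" "\<delta> \<noteq> Ps * pi_sd * (1 + \<beta>)"
    using assms(14) a by (auto simp: D)
  have "\<delta> / (Ps * pi_sd * ln 2) *
     (0.5 * (Ps * pi_sd) / (\<delta> - Ps * pi_sd * (1 - \<beta>)) * Xi1 (\<mu> * (1 - \<beta>)) +
      0.5 * (Ps * pi_sd) / (\<delta> - Ps * pi_sd * (1 + \<beta>)) * Xi1 (\<mu> * (1 + \<beta>)) +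
      Ps * pi_sd * (Ps * pi_sd - \<delta>) / ((\<delta> - Ps * pi_sd * (1 - \<beta>)) * (\<delta> - Ps * pi_sd * (1 + \<beta>))) *
        Xi1 (\<mu> * (\<delta> / (Ps * pi_sd)))) \<le> ergodic_rate_EE Ps Pr Cx pi_sr pi_rr pi_rd pi_sd"
    using nn_integral_integrand_ge unfolding nn_integral_hops_eq[OF ne, folded \<mu>_def]
    by (rule ergodic_rate_EE_ge)
  moreover have "(\<Sum>i\<in>{1,2}. \<kappa> i * Xi1 (Pr * pi_rr * a i / (\<alpha> * Ps * pi_sr) + a i / D))
     = \<kappa> 1 * Xi1 (\<mu> * a 1) + \<kappa> 2 * Xi1 (\<mu> * a 2)"
    unfolding arg by simp
  ultimately show ?thesis
    unfolding arg3 \<kappa>3_def \<kappa>_def a D[symmetric] \<beta>[symmetric] by (simp add: mult.assoc)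
qed

end
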